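(* Let $p_1,\dots,p_n\in\mathbb{R}^d$, let $W\in\mathcal{S}^n$ be the Gram matrix $W_{ij}=p_i^\top p_j$, and let $c_1,\dots,c_k$ be positive integers with $\sum_{j=1}^k c_j=n$. Let $f^\star_{\mathrm{VL}}$, $f^\star_{\mathrm{ML}}$ and $f^\star_{\mathrm{PW}}$ be the optimal values of the vector lifting, matrix lifting and Peng-Wei SDP relaxations associated with these data. Then $$f^\star_{\mathrm{VL}}\ \ge\ f^\star_{\mathrm{ML}}\ \ge\ f^\star_{\mathrm{PW}}.$$
   Context: $\mathcal{S}^n$ is the set of real symmetric $n\times n$ matrices; $\succeq$ is the positive semidefinite (Löwner) order; $\ge$ between matrices is elementwise; $\langle A,B\rangle=\mathrm{tr}(B^\top A)$; $1_n$ is the all-ones vector; $[k]=\{1,\dots,k\}$; $\mathrm{diag}(M)$ is the column vector of diagonal entries of $M$. Let $C=\mathrm{Diag}(c_1,\dots,c_k)$ be the diagonal matrix of cluster sizes. Vector lifting relaxation (VL-SDP): $$f^\star_{\mathrm{VL}}=\min\Big\{\Big\langle W, I_n-\sum_{j=1}^k\tfrac{1}{c_j}\Pi_j\Big\rangle:\ \sum_{j=1}^k\pi_j=1_n,\ (\pi_j,\Pi_j)\in\mathcal{S}_{\mathrm{VL}}(c_j)\ \forall j\in[k]\Big\},$$ where $\mathcal{S}_{\mathrm{VL}}(c)=\{(\pi,\Pi)\in\mathbb{R}^n\times\mathcal{S}^n:\ 1_n^\top\pi=c,\ \mathrm{diag}(\Pi)=\pi,\ \Pi1_n=c\,\pi,\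 \Pi\succeq\pi\pi^\top,\ \Pi\ge 0\}$. Matrix lifting relaxation (ML-SDP): $$f^\star_{\mathrm{ML}}=\min\{\mathrm{tr}(W-WZ):(X,Z)\in\mathcal{S}_{\mathrm{ML}}\},$$ where $\mathcal{S}_{\mathrm{ML}}=\{(X,Z)\in\mathbb{R}^{n\times k}\times\mathcal{S}^n:\ X1_k=1_n,\ X^\top1_n=\mathrm{diag}(C),\ Z1_n=1_n,\ \mathrm{diag}(Z)=X\,\mathrm{diag}(C^{-1}),\ X\ge0,\ Z\ge0,\ Z\succeq XC^{-1}X^\top\}$. Peng-Wei relaxation: $$f^\star_{\mathrm{PW}}=\min\{\mathrm{tr}(W-WZ):\ Z\in\mathcal{S}^n,\ Z1_n=1_n,\ \mathrm{tr}(Z)=k,\ Z\succeq0,\ Z\ge0\}.$$ *)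

theory Defs
  imports "HOL-Analysis.Analysis"
begin

text \<open>
  On \<^typ>\<open>real^'n\<close> the constant \<^term>\<open>1::real^'n\<close> is the all-ones vector, and \<open>\<le>\<close> on vectors and
  matrices is the componentwise order; the identity matrix is \<^term>\<open>mat 1 :: real^'n^'n\<close>.
  An \<open>n \<times> k\<close> matrix has type \<^typ>\<open>real^'k^'n\<close>.
\<close>

definition symmetric_mat :: "real^'n^'n \<Rightarrow> bool" where
  "symmetric_mat A \<longleftrightarrow> transpose A = A"

definition psd :: "real^'n^'n \<Rightarrow> bool" where
  "psd A \<longleftrightarrow> symmetric_mat A \<and> (\<forall>x. 0 \<le> x \<bullet> (A *v x))"

definition loewner_ge :: "real^'n^'n \<Rightarrow> real^'n^'n \<Rightarrow> bool"  (infix \<open>\<succeq>\<close> 50) where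
  "A \<succeq> B \<longleftrightarrow> psd (A - B)"

definition mat_inner :: "real^'m^'n \<Rightarrow> real^'m^'n \<Rightarrow> real" where
  "mat_inner A B = trace (transpose B ** A)"

definition outer :: "real^'n \<Rightarrow> real^'m \<Rightarrow> real^'m^'n" where
  "outer x y = (\<chi> i j. x $ i * y $ j)"

definition diag :: "real^'n^'n \<Rightarrow> real^'n" where
  "diag M = (\<chi> i. M $ i $ i)"

definition Diag :: "real^'n \<Rightarrow> real^'n^'n" where
  "Diag v = (\<chi> i j. if i = j then v $ i else 0)"

definition gram :: "('n \<Rightarrow> real^'d) \<Rightarrow> real^'n^'n" where
  "gram p = (\<chi> i j. p i \<bullet> p j)"

definition size_mat :: "('k \<Rightarrow> nat) \<Rightarrow> real^'k^'k" where
  "size_mat c = Diag (\<chi> j. real (c j))"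

definition S_VL :: "real \<Rightarrow> ((real^'n) \<times> (real^'n^'n)) set" where
  "S_VL c = {(\<pi>, P). symmetric_mat P \<and> 1 \<bullet> \<pi> = c \<and> diag P = \<pi> \<and> P *v 1 = c *\<^sub>R \<pi>
      \<and> P \<succeq> outer \<pi> \<pi> \<and> 0 \<le> P}"

definition S_ML :: "('k \<Rightarrow> nat) \<Rightarrow> ((real^'k^'n) \<times> (real^'n^'n)) set" where
  "S_ML c = (let C = size_mat c in
     {(X, Z). symmetric_mat Z \<and> X *v 1 = 1 \<and> transpose X *v 1 = diag C \<and> Z *v 1 = 1
      \<and> diag Z = X *v diag (matrix_inv C) \<and> 0 \<le> X \<and> 0 \<le> Z
      \<and> Z \<succeq> X ** matrix_inv C ** transpose X})"

definition S_PW :: "nat \<Rightarrow> (real^'n^'n) set" where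
  "S_PW k = {Z. symmetric_mat Z \<and> Z *v 1 = 1 \<and> trace Z = real k \<and> Z \<succeq> 0 \<and> 0 \<le> Z}"

text \<open>
  The optimal values are genuine minima, so they are rendered by \<open>LEAST\<close>. For positive integer
  sizes \<open>c\<close> adding up to \<open>n\<close> all three feasible sets are nonempty (any partition into clusters of
  these sizes gives a feasible point) and compact, so the minima are attained.
\<close>

definition f_VL :: "real^'n^'n \<Rightarrow> ('k::finite \<Rightarrow> nat) \<Rightarrow> real" where
  "f_VL W c = (LEAST v. v \<in>
     {mat_inner W (mat 1 - (\<Sum>j\<in>UNIV. (1 / real (c j)) *\<^sub>R P j)) | \<pi> P.
        (\<Sum>j\<in>UNIV. \<pi> j) = 1 \<and> (\<forall>j. (\<pi> j, P j) \<in> S_VL (real (c j)))})"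

definition f_ML :: "real^'n^'n \<Rightarrow> ('k::finite \<Rightarrow> nat) \<Rightarrow> real" where
  "f_ML W c = (LEAST v. v \<in> {trace (W - W ** Z) | X Z. (X, Z) \<in> S_ML c})"

definition f_PW :: "real^'n^'n \<Rightarrow> nat \<Rightarrow> real" where
  "f_PW W k = (LEAST v. v \<in> {trace (W - W ** Z) | Z. Z \<in> S_PW k})"

end

theory Submission
  imports Defs
begin

text \<open>
  Each inequality holds because a feasible point of the tighter relaxation yields a feasible point of
  the looser one with the same objective value. From a vector lifting point \<open>(\<pi>\<^sub>j, \<Pi>\<^sub>j)\<^sub>j\<close> take for
  \<open>X\<close> the matrix with columns \<open>\<pi>\<^sub>j\<close> and put \<open>Z = \<Sum>\<^sub>j \<Pi>\<^sub>j / c\<^sub>j\<close>. Since \<open>X C\<^sup>-\<^sup>1 X\<^sup>T = \<Sum>\<^sub>j \<pi>\<^sub>j \<pi>\<^sub>j\<^sup>T / c\<^sub>j\<close>,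
  the matrix constraint \<open>Z \<succeq> X C\<^sup>-\<^sup>1 X\<^sup>T\<close> is the weighted sum of the constraints
  \<open>\<Pi>\<^sub>j \<succeq> \<pi>\<^sub>j \<pi>\<^sub>j\<^sup>T\<close>, and the linear constraints add up in the same way
  (\<open>S_VL_family_imp_S_ML\<close>). From a matrix lifting point \<open>(X, Z)\<close> keep \<open>Z\<close>: it dominates a positive
  semidefinite matrix, and the prescribed diagonal together with the column sums \<open>c\<^sub>j\<close> of \<open>X\<close> gives
  trace \<open>k\<close> (\<open>S_ML_imp_S_PW\<close>).

  The comparison of feasible points gives one of optimal values only once each of the three minima is
  known to exist. Existence follows from compactness: all constraints are closed
  conditions, and nonnegativity combined with the equations for the row sums bounds every entry. A
  partition into clusters of the given sizes supplies a feasible point of the vector lifting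
  (\<open>VL_matrices_nonempty\<close>), which the two maps above carry to the other relaxations.
\<close>

section \<open>Minima over compact sets\<close>

text \<open>
  On the reals \<open>LEAST\<close> is unspecified unless a least element exists; a continuous function on a nonempty
  compact set provides one.
\<close>

lemma Least_compact_image:
  fixes g :: "'a::topological_space \<Rightarrow> real"
  assumes "compact S" "S \<noteq> {}" "continuous_on S g"
  shows Least_compact_image_in: "(LEAST v. v \<in> g ` S) \<in> g ` S"
    and Least_compact_image_le: "v \<in> g ` S \<Longrightarrow> (LEAST v. v \<in> g ` S) \<le> v"
proof -
  obtain m where m: "m \<in> S" "\<forall>x\<in>S. g m \<le> g x"
    using continuous_attains_inf[OF assms] by blast
  then have eq: "(LEAST v. v \<in> g ` S) = g m"
    by (intro Least_equality) auto
  show "(LEAST v. v \<in> g ` S) \<in> g ` S" using m eq by simp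
  show "v \<in> g ` S \<Longrightarrow> (LEAST v. v \<in> g ` S) \<le> v" using m eq by auto
qed

section \<open>Positive semidefinite matrices\<close>

lemma symmetric_mat_iff: "symmetric_mat A \<longleftrightarrow> (\<forall>i j. A $ i $ j = A $ j $ i)"
  by (auto simp: symmetric_mat_def transpose_def vec_eq_iff)

lemma nonneg_mat_iff: "0 \<le> (A::real^'m^'n) \<longleftrightarrow> (\<forall>i j. 0 \<le> A $ i $ j)"
  by (simp add: less_eq_vec_def)

lemma mat_mult_one_iff: "A *v 1 = b \<longleftrightarrow> (\<forall>i. (\<Sum>j\<in>UNIV. A $ i $ j) = b $ i)"
  for A :: "real^'m^'n"
  by (simp add: vec_eq_iff matrix_vector_mult_def)

lemma psd_zero: "psd (0 :: real^'n^'n)"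
  by (simp add: psd_def symmetric_mat_iff)

lemma psd_add: "psd A \<Longrightarrow> psd B \<Longrightarrow> psd (A + B)"
  by (simp add: psd_def symmetric_mat_iff matrix_vector_mult_add_rdistrib inner_add_right)

lemma psd_scaleR: "0 \<le> r \<Longrightarrow> psd A \<Longrightarrow> psd (r *\<^sub>R A)"
  by (simp add: psd_def symmetric_mat_iff scaleR_matrix_vector_assoc[symmetric])

lemma psd_sum: "(\<And>j. j \<in> J \<Longrightarrow> psd (A j)) \<Longrightarrow> psd (\<Sum>j\<in>J. A j)"
  by (induction J rule: infinite_finite_induct) (auto simp: psd_zero psd_add)

lemma psd_outer_self: "psd (outer x x)"
proof -
  have "y \<bullet> (outer x x *v y) = (x \<bullet> y)\<^sup>2" for y
    by (simp add: outer_def matrix_vector_mult_def inner_vec_def power2_eq_square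
        sum_product sum_distrib_left mult_ac)
  then show ?thesis
    by (simp add: psd_def symmetric_mat_iff outer_def mult.commute)
qed

lemma continuous_on_matrix_vector_left:
  fixes f :: "'a::topological_space \<Rightarrow> real^'m^'n"
  assumes "continuous_on S f"
  shows "continuous_on S (\<lambda>z. f z *v x)"
  unfolding matrix_vector_mult_def
  by (intro continuous_intros assms)

lemma closed_Collect_symmetric_mat:
  fixes f :: "'a::topological_space \<Rightarrow> real^'n^'n"
  assumes "continuous_on UNIV f"
  shows "closed {z. symmetric_mat (f z)}"
  unfolding symmetric_mat_iff
  by (intro closed_Collect_all closed_Collect_eq continuous_intros assms)

lemma closed_Collect_psd:
  fixes f :: "'a::topological_space \<Rightarrow> real^'n^'n"
  assumes "continuous_on UNIV f"
  shows "closed {z. psd (f z)}"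
  unfolding psd_def
  by (intro closed_Collect_conj closed_Collect_symmetric_mat closed_Collect_all closed_Collect_le
      continuous_intros continuous_on_matrix_vector_left assms)

lemma closed_Collect_nonneg_mat:
  fixes f :: "'a::topological_space \<Rightarrow> real^'m^'n"
  assumes "continuous_on UNIV f"
  shows "closed {z. 0 \<le> f z}"
  unfolding nonneg_mat_iff
  by (intro closed_Collect_all closed_Collect_le continuous_intros assms)

lemma continuous_on_outer:
  fixes f :: "'a::topological_space \<Rightarrow> real^'n" and g :: "'a \<Rightarrow> real^'m"
  assumes "continuous_on S f" "continuous_on S g"
  shows "continuous_on S (\<lambda>z. outer (f z) (g z))"
  unfolding outer_def by (intro continuous_intros assms)

lemma continuous_on_diag:
  fixes f :: "'a::topological_space \<Rightarrow> real^'n^'n"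
  assumes "continuous_on S f"
  shows "continuous_on S (\<lambda>z. diag (f z))"
  unfolding diag_def by (intro continuous_intros assms)

lemma continuous_on_trace_mult:
  fixes f :: "'a::topological_space \<Rightarrow> real^'n^'n"
  assumes "continuous_on S f"
  shows "continuous_on S (\<lambda>z. trace (W - W ** f z))"
  unfolding trace_def matrix_matrix_mult_def by (simp, intro continuous_intros assms)

lemma norm_vec_le_card_mult:
  fixes x :: "'a::real_normed_vector^'n"
  assumes "\<And>i. norm (x $ i) \<le> b"
  shows "norm x \<le> real CARD('n) * b"
proof -
  have "norm x \<le> (\<Sum>i\<in>UNIV. norm (x $ i))"
    by (simp add: norm_vec_def L2_set_le_sum)
  also have "\<dots> \<le> real CARD('n) * b"
    using assms by (intro sum_bounded_above) auto
  finally show ?thesis .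
qed

lemma norm_mat_le_card_mult:
  fixes A :: "real^'m^'n"
  assumes "\<And>i j. \<bar>A $ i $ j\<bar> \<le> b"
  shows "norm A \<le> real CARD('n) * (real CARD('m) * b)"
  using assms by (intro norm_vec_le_card_mult) auto

section \<open>The cluster size matrix\<close>

lemma matrix_inv_size_mat:
  fixes c :: "'k::finite \<Rightarrow> nat"
  assumes "\<And>j. 0 < c j"
  shows "matrix_inv (size_mat c) = Diag (\<chi> j. 1 / real (c j))"
proof -
  let ?D = "Diag (\<chi> j. 1 / real (c j))"
  have inv: "size_mat c ** ?D = mat 1" "?D ** size_mat c = mat 1"
    using assms
    by (auto simp: size_mat_def Diag_def matrix_matrix_mult_def mat_def vec_eq_iff
        if_distrib[of "\<lambda>x. x * _"] cong: if_cong)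
  then have "size_mat c ** matrix_inv (size_mat c) = mat 1 \<and> matrix_inv (size_mat c) ** size_mat c = mat 1"
    unfolding matrix_inv_def by (intro someI) blast
  then show ?thesis
    using inv by (metis matrix_mul_assoc matrix_mul_lid matrix_mul_rid)
qed

text \<open>
  This form of \<open>X C\<^sup>-\<^sup>1 X\<^sup>T\<close> makes the semidefinite constraint of the matrix lifting comparable, cluster by
  cluster, with those of the vector lifting.
\<close>

lemma size_weighted_gram_eq_sum_outer:
  fixes X :: "real^'k^'n"
  assumes "\<And>j. 0 < c j"
  shows "X ** matrix_inv (size_mat c) ** transpose X
    = (\<Sum>j\<in>UNIV. (1 / real (c j)) *\<^sub>R outer (column j X) (column j X))"
  unfolding matrix_inv_size_mat[OF assms]
  by (simp add: vec_eq_iff matrix_matrix_mult_def Diag_def outer_def column_def transpose_def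
      if_distrib[of "\<lambda>x. _ * x"] mult_ac cong: if_cong)

lemma mem_S_ML_iff:
  fixes c :: "'k::finite \<Rightarrow> nat" and X :: "real^'k^'n"
  assumes "\<And>j. 0 < c j"
  shows "(X, Z) \<in> S_ML c \<longleftrightarrow> symmetric_mat Z \<and> (\<forall>i. (\<Sum>j\<in>UNIV. X $ i $ j) = 1)
     \<and> (\<forall>j. (\<Sum>i\<in>UNIV. X $ i $ j) = real (c j)) \<and> Z *v 1 = 1
     \<and> (\<forall>i. Z $ i $ i = (\<Sum>j\<in>UNIV. X $ i $ j / real (c j))) \<and> 0 \<le> X \<and> 0 \<le> Z
     \<and> psd (Z - (\<Sum>j\<in>UNIV. (1 / real (c j)) *\<^sub>R outer (column j X) (column j X)))"
proof -
  have "transpose X *v 1 = diag (size_mat c) \<longleftrightarrow> (\<forall>j. (\<Sum>i\<in>UNIV. X $ i $ j) = real (c j))"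
    by (simp add: mat_mult_one_iff transpose_def diag_def size_mat_def Diag_def)
  moreover have "diag Z = X *v diag (matrix_inv (size_mat c))
      \<longleftrightarrow> (\<forall>i. Z $ i $ i = (\<Sum>j\<in>UNIV. X $ i $ j / real (c j)))"
    by (simp add: matrix_inv_size_mat[OF assms] vec_eq_iff diag_def Diag_def matrix_vector_mult_def)
  ultimately show ?thesis
    by (simp add: S_ML_def Let_def loewner_ge_def size_weighted_gram_eq_sum_outer[OF assms]
        mat_mult_one_iff[of X])
qed

section \<open>Maps between the feasible sets\<close>

text \<open>
  Summing \<open>Z\<^sub>i\<^sub>i = \<Sum>\<^sub>j X\<^sub>i\<^sub>j / c\<^sub>j\<close> over \<open>i\<close> first turns each column of \<open>X\<close> into \<open>c\<^sub>j / c\<^sub>j = 1\<close>, whence the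
  trace; adding \<open>X C\<^sup>-\<^sup>1 X\<^sup>T \<succeq> 0\<close> back to \<open>Z - X C\<^sup>-\<^sup>1 X\<^sup>T \<succeq> 0\<close> gives \<open>Z \<succeq> 0\<close>.
\<close>

lemma S_ML_imp_S_PW:
  fixes c :: "'k::finite \<Rightarrow> nat" and X :: "real^'k^'n"
  assumes c: "\<And>j. 0 < c j" and XZ: "(X, Z) \<in> S_ML c"
  shows "Z \<in> S_PW CARD('k)"
proof -
  let ?Y = "\<Sum>j\<in>UNIV. (1 / real (c j)) *\<^sub>R outer (column j X) (column j X)"
  note ml = XZ[unfolded mem_S_ML_iff[OF c]]
  have "trace Z = (\<Sum>i\<in>UNIV. \<Sum>j\<in>UNIV. X $ i $ j / real (c j))"
    using ml by (simp add: trace_def)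
  also have "\<dots> = (\<Sum>j\<in>UNIV. (\<Sum>i\<in>UNIV. X $ i $ j) / real (c j))"
    by (subst sum.swap) (simp add: sum_divide_distrib)
  also have "\<dots> = real CARD('k)"
    using ml c by (simp add: less_imp_neq[symmetric])
  finally have tr: "trace Z = real CARD('k)" .
  have "psd ((Z - ?Y) + ?Y)"
    using ml by (intro psd_add psd_sum psd_scaleR psd_outer_self) auto
  then show ?thesis
    using ml tr by (simp add: S_PW_def loewner_ge_def)
qed

text \<open>
  The weights \<open>1 / c\<^sub>j\<close> cancel the factor \<open>c\<^sub>j\<close> in \<open>\<Pi>\<^sub>j 1 = c\<^sub>j \<pi>\<^sub>j\<close>, so the rows of the weighted sum add up to
  \<open>\<Sum>\<^sub>j \<pi>\<^sub>j = 1\<close>; and the semidefinite gap of the new point is the weighted sum of the gaps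
  \<open>\<Pi>\<^sub>j - \<pi>\<^sub>j \<pi>\<^sub>j\<^sup>T\<close>.
\<close>

lemma S_VL_family_imp_S_ML:
  fixes c :: "'k::finite \<Rightarrow> nat" and P :: "'k \<Rightarrow> real^'n^'n"
  assumes c: "\<And>j. 0 < c j"
    and sum1: "(\<Sum>j\<in>UNIV. \<pi> j) = 1"
    and vl: "\<And>j. (\<pi> j, P j) \<in> S_VL (real (c j))"
  shows "((\<chi> i j. \<pi> j $ i), (\<Sum>j\<in>UNIV. (1 / real (c j)) *\<^sub>R P j)) \<in> S_ML c"
    (is "(?X, ?Z) \<in> _")
proof -
  note vl' = vl[unfolded S_VL_def loewner_ge_def, simplified]
  have sym: "P j $ a $ b = P j $ b $ a" for j a b
    using vl'[of j] by (simp add: symmetric_mat_iff)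
  have nonneg: "0 \<le> P j $ a $ b" for j a b
    using vl'[of j] by (simp add: nonneg_mat_iff)
  have diag: "P j $ a $ a = \<pi> j $ a" for j a
    using vl'[of j] by (auto simp: diag_def vec_eq_iff)
  have rows: "(\<Sum>b\<in>UNIV. P j $ a $ b) = real (c j) * \<pi> j $ a" for j a
    using vl'[of j] by (simp add: mat_mult_one_iff)
  have total: "(\<Sum>a\<in>UNIV. \<pi> j $ a) = real (c j)" for j
    using vl'[of j] by (simp add: inner_vec_def)
  have cover: "(\<Sum>j\<in>UNIV. \<pi> j $ a) = 1" for a
    using arg_cong[OF sum1, of "\<lambda>v. v $ a"] by simp
  have "column j ?X = \<pi> j" for j
    by (simp add: column_def vec_eq_iff)
  then have "?Z - (\<Sum>j\<in>UNIV. (1 / real (c j)) *\<^sub>R outer (column j ?X) (column j ?X))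
      = (\<Sum>j\<in>UNIV. (1 / real (c j)) *\<^sub>R (P j - outer (\<pi> j) (\<pi> j)))"
    by (simp add: sum_subtractf scaleR_diff_right)
  moreover have "psd \<dots>"
    using vl' by (intro psd_sum psd_scaleR) auto
  ultimately have psd: "psd (?Z - (\<Sum>j\<in>UNIV. (1 / real (c j)) *\<^sub>R outer (column j ?X) (column j ?X)))"
    by simp
  have "(\<Sum>b\<in>UNIV. ?Z $ a $ b) = 1" for a
  proof -
    have "(\<Sum>b\<in>UNIV. ?Z $ a $ b) = (\<Sum>j\<in>UNIV. (\<Sum>b\<in>UNIV. P j $ a $ b) / real (c j))"
      by (simp, subst sum.swap) (simp add: sum_divide_distrib)
    also have "\<dots> = (\<Sum>j\<in>UNIV. \<pi> j $ a)"
      using c by (simp add: rows less_imp_neq[symmetric])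
    finally show ?thesis by (simp add: cover)
  qed
  then have "?Z *v 1 = 1"
    by (simp only: mat_mult_one_iff one_index) simp
  moreover have "0 \<le> ?X" "0 \<le> ?Z" "symmetric_mat ?Z"
    using nonneg diag sym by (auto simp: nonneg_mat_iff symmetric_mat_iff diag[symmetric] intro!: sum_nonneg)
  ultimately show ?thesis
    using psd by (simp add: mem_S_ML_iff[OF c] cover total diag)
qed

lemma matrix_diff_mult_distrib: "(A - B) ** C = A ** C - B ** C"
  for A B :: "'a::ring_1^'m^'n" and C :: "'a^'l^'m"
  by (simp add: vec_eq_iff matrix_matrix_mult_def left_diff_distrib sum_subtractf)

text \<open>
  The vector lifting objective is written as an inner product and the other two as a trace;
  symmetry and cyclicity of the trace identify them.
\<close>

lemma mat_inner_id_minus_symmetric: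
  fixes W Z :: "real^'n^'n"
  assumes "symmetric_mat Z"
  shows "mat_inner W (mat 1 - Z) = trace (W - W ** Z)"
proof -
  have "transpose (mat 1 - Z) = mat 1 - Z"
    using assms by (simp add: symmetric_mat_def transpose_def mat_def vec_eq_iff)
  then have "mat_inner W (mat 1 - Z) = trace (W - Z ** W)"
    by (simp add: mat_inner_def matrix_diff_mult_distrib)
  also have "\<dots> = trace (W - W ** Z)"
    by (simp add: trace_sub trace_mul_sym[of Z W])
  finally show ?thesis .
qed

section \<open>Nonemptiness and compactness of the feasible sets\<close>

text \<open>
  Pairs \<open>(j, m)\<close> with \<open>m < c j\<close> represent the places available in the clusters. There are as many
  places as points, and a bijection between points and places assigns each point to a cluster.
\<close>

lemma ex_assignment_with_sizes:
  fixes c :: "'k::finite \<Rightarrow> nat"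
  assumes "(\<Sum>j\<in>UNIV. c j) = CARD('n::finite)"
  obtains \<sigma> :: "'n::finite \<Rightarrow> 'k" where "\<And>j. card {i. \<sigma> i = j} = c j"
proof -
  let ?S = "SIGMA j:UNIV. {..<c j}"
  have "card (UNIV::'n set) = card ?S"
    using assms by (simp add: card_SigmaI)
  then obtain h where h: "bij_betw h (UNIV::'n set) ?S"
    using finite_same_card_bij[of "UNIV::'n set" ?S] by auto
  have "card {i. fst (h i) = j} = c j" for j
  proof -
    have "h ` {i. fst (h i) = j} = {x \<in> range h. fst x = j}"
      by auto
    also have "\<dots> = {j} \<times> {..<c j}"
      unfolding bij_betw_imp_surj_on[OF h] by auto
    finally have "h ` {i. fst (h i) = j} = {j} \<times> {..<c j}" .
    moreover have "inj_on h {i. fst (h i) = j}"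
      using h by (auto simp: bij_betw_def inj_on_def)
    ultimately show ?thesis
      using card_image[of h "{i. fst (h i) = j}"] by simp
  qed
  then show thesis by (rule that[of "\<lambda>i. fst (h i)"])
qed

text \<open>
  A genuine cluster is feasible with equality in the semidefinite constraint, because a vector with
  entries 0 and 1 equals its entrywise square.
\<close>

lemma indicator_in_S_VL:
  fixes A :: "'n::finite set"
  defines "\<pi> \<equiv> (\<chi> i. indicator A i) :: real^'n"
  shows "(\<pi>, outer \<pi> \<pi>) \<in> S_VL (real (card A))"
proof -
  have size: "(\<Sum>i\<in>UNIV. indicator A i) = real (card A)"
    by (simp add: indicator_def)
  have idem: "diag (outer \<pi> \<pi>) = \<pi>"
    by (simp add: diag_def outer_def \<pi>_def vec_eq_iff indicator_def)
  have total: "1 \<bullet> \<pi> = real (card A)"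
    by (simp add: inner_vec_def \<pi>_def size)
  have "outer \<pi> \<pi> *v 1 = real (card A) *\<^sub>R \<pi>"
    using size by (simp add: mat_mult_one_iff outer_def \<pi>_def sum_distrib_left[symmetric])
  moreover have "symmetric_mat (outer \<pi> \<pi>)" "0 \<le> outer \<pi> \<pi>"
    by (simp_all add: symmetric_mat_iff nonneg_mat_iff outer_def \<pi>_def mult.commute)
  ultimately show ?thesis
    using idem total by (simp add: S_VL_def loewner_ge_def psd_zero)
qed

lemma entry_le_row_sum:
  fixes A :: "real^'m^'n"
  assumes "0 \<le> A"
  shows "\<bar>A $ i $ j\<bar> \<le> (\<Sum>j\<in>UNIV. A $ i $ j)"
  using assms member_le_sum[of j UNIV "\<lambda>j. A $ i $ j"] by (simp add: nonneg_mat_iff)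

lemma compact_S_PW: "compact (S_PW k :: (real^'n^'n) set)"
proof -
  have "closed (S_PW k :: (real^'n^'n) set)"
    unfolding S_PW_def loewner_ge_def trace_def
    by (intro closed_Collect_conj closed_Collect_symmetric_mat closed_Collect_psd
        closed_Collect_nonneg_mat closed_Collect_eq continuous_on_matrix_vector_left continuous_intros)
  moreover have "bounded (S_PW k :: (real^'n^'n) set)"
  proof (rule boundedI)
    fix A :: "real^'n^'n"
    assume "A \<in> S_PW k"
    then have "\<bar>A $ i $ j\<bar> \<le> 1" for i j
      using entry_le_row_sum[of A i j] by (simp add: S_PW_def mat_mult_one_iff)
    then show "norm A \<le> real CARD('n) * (real CARD('n) * 1)"
      by (rule norm_mat_le_card_mult)
  qed
  ultimately show ?thesis by (simp add: compact_eq_bounded_closed)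
qed

lemma compact_S_ML:
  fixes c :: "'k::finite \<Rightarrow> nat"
  assumes c: "\<And>j. 0 < c j"
  shows "compact (S_ML c :: ((real^'k^'n) \<times> (real^'n^'n)) set)"
proof -
  have "closed {XZ :: (real^'k^'n) \<times> (real^'n^'n). (fst XZ, snd XZ) \<in> S_ML c}"
    \<comment> \<open>As products with constants the quotients are continuous without a side condition.\<close>
    unfolding mem_S_ML_iff[OF c] column_def divide_inverse
    by (intro closed_Collect_conj closed_Collect_all closed_Collect_symmetric_mat closed_Collect_psd
        closed_Collect_nonneg_mat closed_Collect_eq continuous_on_matrix_vector_left
        continuous_on_outer continuous_intros)
  then have "closed (S_ML c :: ((real^'k^'n) \<times> (real^'n^'n)) set)"
    by simp
  moreover have "bounded (S_ML c :: ((real^'k^'n) \<times> (real^'n^'n)) set)"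
  proof (rule boundedI, clarify)
    fix X :: "real^'k^'n" and Z :: "real^'n^'n"
    assume "(X, Z) \<in> S_ML c"
    then have ml: "0 \<le> X" "0 \<le> Z" "\<And>i. (\<Sum>j\<in>UNIV. X $ i $ j) = 1" "\<And>i. (\<Sum>j\<in>UNIV. Z $ i $ j) = 1"
      by (auto simp: mem_S_ML_iff[OF c] mat_mult_one_iff)
    have "\<bar>X $ i $ j\<bar> \<le> 1" "\<bar>Z $ i $ l\<bar> \<le> 1" for i j l
      using entry_le_row_sum[OF ml(1), of i j] entry_le_row_sum[OF ml(2), of i l] ml(3,4) by simp_all
    then have "norm X \<le> real CARD('n) * (real CARD('k) * 1)" "norm Z \<le> real CARD('n) * (real CARD('n) * 1)"
      by (intro norm_mat_le_card_mult; simp)+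
    then show "norm (X, Z) \<le> real CARD('n) * (real CARD('k) * 1) + real CARD('n) * (real CARD('n) * 1)"
      using norm_Pair_le[of X Z] by linarith
  qed
  ultimately show ?thesis by (simp add: compact_eq_bounded_closed)
qed

text \<open>
  The vectors \<open>\<pi>\<^sub>j\<close> are the diagonals of the \<open>\<Pi>\<^sub>j\<close>, so the feasible set is described by the matrices
  alone. Indexing them by a vector type places the set in a Euclidean space, where compact means
  closed and bounded.
\<close>

definition VL_matrices :: "('k::finite \<Rightarrow> nat) \<Rightarrow> ((real^'n^'n)^'k) set" where
  "VL_matrices c = {P. (\<Sum>j\<in>UNIV. diag (P $ j)) = 1
     \<and> (\<forall>j. (diag (P $ j), P $ j) \<in> S_VL (real (c j)))}"

text \<open>
  The diagonals are nonnegative and sum to the all-ones vector over the clusters, so each is at most 1;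
  hence the rows of \<open>\<Pi>\<^sub>j\<close> have sum at most \<open>c\<^sub>j\<close>, and this bounds the nonnegative entries.
\<close>

lemma compact_VL_matrices:
  "compact (VL_matrices c :: ((real^'n^'n)^'k::finite) set)"
proof -
  have "closed (VL_matrices c :: ((real^'n^'n)^'k) set)"
    unfolding VL_matrices_def S_VL_def loewner_ge_def mem_Collect_eq prod.case
    by (intro closed_Collect_conj closed_Collect_all closed_Collect_symmetric_mat closed_Collect_psd
        closed_Collect_nonneg_mat closed_Collect_eq continuous_on_matrix_vector_left
        continuous_on_outer continuous_on_diag continuous_intros)
  moreover have "bounded (VL_matrices c :: ((real^'n^'n)^'k) set)"
  proof (rule boundedI)
    let ?m = "Max (range (\<lambda>j. real (c j)))"
    fix P :: "(real^'n^'n)^'k"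
    assume P: "P \<in> VL_matrices c"
    have "\<bar>P $ j $ a $ b\<bar> \<le> ?m" for j a b
    proof -
      have nonneg: "0 \<le> P $ l" for l
        using P by (simp add: VL_matrices_def S_VL_def)
      have "P $ j $ a $ a \<le> (\<Sum>l\<in>UNIV. P $ l $ a $ a)"
        using nonneg by (intro member_le_sum) (auto simp: nonneg_mat_iff)
      also have "\<dots> = (\<Sum>l\<in>UNIV. diag (P $ l)) $ a"
        by (simp add: diag_def)
      also have "\<dots> = 1"
        using P by (simp add: VL_matrices_def)
      finally have diag_le: "P $ j $ a $ a \<le> 1" .
      have "\<bar>P $ j $ a $ b\<bar> \<le> (\<Sum>b\<in>UNIV. P $ j $ a $ b)"
        by (rule entry_le_row_sum[OF nonneg])
      also have "\<dots> = real (c j) * P $ j $ a $ a"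
        using P by (simp add: VL_matrices_def S_VL_def mat_mult_one_iff diag_def)
      also have "\<dots> \<le> real (c j)"
        using diag_le by (intro mult_left_le) auto
      also have "\<dots> \<le> ?m" by (intro Max_ge) auto
      finally show ?thesis .
    qed
    then show "norm P \<le> real CARD('k) * (real CARD('n) * (real CARD('n) * ?m))"
      by (intro norm_vec_le_card_mult[of P] norm_mat_le_card_mult)
  qed
  ultimately show ?thesis by (simp add: compact_eq_bounded_closed)
qed

lemma VL_matrices_nonempty:
  fixes c :: "'k::finite \<Rightarrow> nat"
  assumes "(\<Sum>j\<in>UNIV. c j) = CARD('n::finite)"
  shows "VL_matrices c \<noteq> ({} :: ((real^'n::finite^'n::finite)^'k) set)"
proof -
  obtain \<sigma> :: "'n \<Rightarrow> 'k" where \<sigma>: "\<And>j. card {i. \<sigma> i = j} = c j"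
    using ex_assignment_with_sizes[OF assms] by blast
  define \<pi> :: "'k \<Rightarrow> real^'n" where "\<pi> j = (\<chi> i. indicator {i. \<sigma> i = j} i)" for j
  have vl: "(\<pi> j, outer (\<pi> j) (\<pi> j)) \<in> S_VL (real (c j))" for j
    using indicator_in_S_VL[of "{i. \<sigma> i = j}"] by (simp add: \<sigma> \<pi>_def)
  then have "diag (outer (\<pi> j) (\<pi> j)) = \<pi> j" for j
    by (simp add: S_VL_def)
  moreover have "(\<Sum>j\<in>UNIV. \<pi> j) = 1"
    by (simp add: vec_eq_iff indicator_def \<pi>_def)
  ultimately have "(\<chi> j. outer (\<pi> j) (\<pi> j)) \<in> VL_matrices c"
    using vl by (simp add: VL_matrices_def)
  then show ?thesis by blast
qed

section \<open>The chain of bounds\<close>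

lemma f_VL_eq:
  "f_VL W c = (LEAST v. v \<in>
    (\<lambda>P. mat_inner W (mat 1 - (\<Sum>j\<in>UNIV. (1 / real (c j)) *\<^sub>R P $ j))) ` VL_matrices c)"
proof -
  have "{mat_inner W (mat 1 - (\<Sum>j\<in>UNIV. (1 / real (c j)) *\<^sub>R P j)) | \<pi> P.
        (\<Sum>j\<in>UNIV. \<pi> j) = 1 \<and> (\<forall>j. (\<pi> j, P j) \<in> S_VL (real (c j)))}
     = (\<lambda>P. mat_inner W (mat 1 - (\<Sum>j\<in>UNIV. (1 / real (c j)) *\<^sub>R P $ j))) ` VL_matrices c"
    (is "?L = ?g ` _")
  proof (intro equalityI subsetI)
    fix v assume "v \<in> ?L"
    then obtain \<pi> P where v: "v = mat_inner W (mat 1 - (\<Sum>j\<in>UNIV. (1 / real (c j)) *\<^sub>R P j))"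
      and 1: "(\<Sum>j\<in>UNIV. \<pi> j) = 1" and vl: "\<And>j. (\<pi> j, P j) \<in> S_VL (real (c j))" by blast
    have "diag (P j) = \<pi> j" for j using vl[of j] by (simp add: S_VL_def)
    then have "(\<chi> j. P j) \<in> VL_matrices c" using 1 vl by (simp add: VL_matrices_def)
    then show "v \<in> ?g ` VL_matrices c" by (rule rev_image_eqI) (simp add: v)
  next
    fix v assume "v \<in> ?g ` VL_matrices c"
    then obtain P where "P \<in> VL_matrices c" "v = ?g P" by blast
    then show "v \<in> ?L"
      by (auto simp: VL_matrices_def intro!: exI[of _ "\<lambda>j. diag (P $ j)"] exI[of _ "\<lambda>j. P $ j"])
  qed
  then show ?thesis by (simp add: f_VL_def)
qed

lemma f_ML_eq:
  "f_ML W c = (LEAST v. v \<in> (\<lambda>XZ. trace (W - W ** snd XZ)) ` S_ML c)"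
proof -
  have "{trace (W - W ** Z) | X Z. (X, Z) \<in> S_ML c} = (\<lambda>XZ. trace (W - W ** snd XZ)) ` S_ML c"
    by (auto intro: rev_image_eqI) blast
  then show ?thesis by (simp add: f_ML_def)
qed

lemma f_PW_eq: "f_PW W k = (LEAST v. v \<in> (\<lambda>Z. trace (W - W ** Z)) ` S_PW k)"
proof -
  have "{trace (W - W ** Z) | Z. Z \<in> S_PW k} = (\<lambda>Z. trace (W - W ** Z)) ` S_PW k"
    by auto
  then show ?thesis by (simp add: f_PW_def)
qed

theorem proposition2:
  fixes p :: "'n::finite \<Rightarrow> real^'d"
    and W :: "real^'n^'n"
    and c :: "'k::finite \<Rightarrow> nat"
  assumes "W = gram p"
    and "\<And>j. 0 < c j"
    and "(\<Sum>j\<in>UNIV. c j) = CARD('n)"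
  shows "f_VL W c \<ge> f_ML W c \<and> f_ML W c \<ge> f_PW W CARD('k)"
proof -
  let ?gVL = "\<lambda>P :: (real^'n^'n)^'k. mat_inner W (mat 1 - (\<Sum>j\<in>UNIV. (1 / real (c j)) *\<^sub>R P $ j))"
  let ?g = "\<lambda>Z. trace (W - W ** Z)"
  let ?ZVL = "\<lambda>P :: (real^'n^'n)^'k. (\<Sum>j\<in>UNIV. (1 / real (c j)) *\<^sub>R P $ j)"
  have VL_ML: "((\<chi> i j. diag (P $ j) $ i), ?ZVL P) \<in> S_ML c \<and> ?gVL P = ?g (?ZVL P)"
    if "P \<in> VL_matrices c" for P
  proof -
    have ml: "((\<chi> i j. diag (P $ j) $ i), ?ZVL P) \<in> S_ML c"
      using that S_VL_family_imp_S_ML[of c "\<lambda>j. diag (P $ j)" "\<lambda>j. P $ j"] assms(2)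
      by (simp add: VL_matrices_def)
    then have "symmetric_mat (?ZVL P)" by (simp add: mem_S_ML_iff[OF assms(2)])
    then show ?thesis using ml mat_inner_id_minus_symmetric by blast
  qed
  have ne_VL: "VL_matrices c \<noteq> ({} :: ((real^'n^'n)^'k) set)"
    using assms(3) by (rule VL_matrices_nonempty)
  then have ne_ML: "S_ML c \<noteq> ({} :: ((real^'k^'n) \<times> (real^'n^'n)) set)"
    using VL_ML by blast
  then have ne_PW: "S_PW CARD('k) \<noteq> ({} :: (real^'n^'n) set)"
    using S_ML_imp_S_PW[OF assms(2)] by fast
  have cont_VL: "continuous_on (VL_matrices c) ?gVL"
    unfolding mat_inner_def trace_def matrix_matrix_mult_def transpose_def
    using assms(2) by (simp, intro continuous_intros ballI) (metis less_irrefl of_nat_eq_0_iff)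
  have cont_ML: "continuous_on (S_ML c) (\<lambda>XZ. ?g (snd (XZ :: (real^'k^'n) \<times> (real^'n^'n))))"
    by (intro continuous_on_trace_mult continuous_intros)
  have cont_PW: "continuous_on (S_PW CARD('k)) ?g"
    by (intro continuous_on_trace_mult continuous_intros)

  obtain P where P: "P \<in> VL_matrices c" "f_VL W c = ?gVL P"
    using Least_compact_image_in[OF compact_VL_matrices ne_VL cont_VL] by (auto simp: f_VL_eq)
  have "f_ML W c \<le> f_VL W c"
    unfolding f_ML_eq
    by (rule Least_compact_image_le[OF compact_S_ML[OF assms(2)] ne_ML cont_ML])
      (use VL_ML[OF P(1)] P(2) in \<open>auto intro: rev_image_eqI\<close>)
  moreover obtain X :: "real^'k^'n" and Z where XZ: "(X, Z) \<in> S_ML c" "f_ML W c = ?g Z"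
    using Least_compact_image_in[OF compact_S_ML[OF assms(2)] ne_ML cont_ML] by (auto simp: f_ML_eq)
  have "f_PW W CARD('k) \<le> f_ML W c"
    unfolding f_PW_eq
    by (rule Least_compact_image_le[OF compact_S_PW ne_PW cont_PW])
      (use S_ML_imp_S_PW[OF assms(2) XZ(1)] XZ(2) in blast)
  ultimately show ?thesis by blast
qed

end
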